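(* Let $$A=\Big\{x:\lim_{n\to\infty}\frac1n\log q_n(x)=\frac{\gamma_0}2\Big\},\quad B=\Big\{x:\lim_{n\to\infty}\frac1n\sum_{j=1}^n\log a_j(x)=0\Big\},\quad C=\Big\{x:\lim_{n\to\infty}\frac1n\sharp N_n(x)=0\Big\},$$ where $x$ ranges over the irrational numbers in $[0,1]$. Then $A=B\subset C$.
   Context: For irrational $x\in[0,1]$, $x=[a_1(x),a_2(x),\dots]$ is its continued fraction expansion, $q_n(x)$ is the denominator of its $n$-th convergent $p_n/q_n=[a_1(x),\dots,a_n(x)]$ (so $q_{-1}=0$, $q_0=1$, $q_n=a_nq_{n-1}+q_{n-2}$), $N_n(x)=\{j\le n:a_j(x)\ne1\}$, $\sharp$ denotes cardinality, and $\gamma_0=2\log\frac{1+\sqrt5}2$. *)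

theory Defs
  imports Complex_Main
begin

definition irrationals01 :: "real set" where
  "irrationals01 = {x. 0 \<le> x \<and> x \<le> 1 \<and> x \<notin> \<rat>}"

definition gauss_map :: "real \<Rightarrow> real" where
  "gauss_map x = frac (1 / x)"

text \<open>The partial quotients are indexed from 1; index 0 holds the integer part of \<open>x\<close>, which is 0.\<close>

primrec cf_digit :: "real \<Rightarrow> nat \<Rightarrow> nat" where
  "cf_digit x 0 = 0"
| "cf_digit x (Suc n) = nat \<lfloor>1 / (gauss_map ^^ n) x\<rfloor>"

text \<open>In the next two recursions the equations at \<open>Suc 0\<close> absorb the initial values
  \<open>p\<^sub>-\<^sub>1 = 1\<close> and \<open>q\<^sub>-\<^sub>1 = 0\<close>.\<close>

fun cf_num :: "real \<Rightarrow> nat \<Rightarrow> nat" where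
  "cf_num x 0 = 0"
| "cf_num x (Suc 0) = 1"
| "cf_num x (Suc (Suc n)) = cf_digit x (Suc (Suc n)) * cf_num x (Suc n) + cf_num x n"

fun cf_denom :: "real \<Rightarrow> nat \<Rightarrow> nat" where
  "cf_denom x 0 = 1"
| "cf_denom x (Suc 0) = cf_digit x (Suc 0)"
| "cf_denom x (Suc (Suc n)) = cf_digit x (Suc (Suc n)) * cf_denom x (Suc n) + cf_denom x n"

definition non_one_indices :: "real \<Rightarrow> nat \<Rightarrow> nat set" where
  "non_one_indices x n = {j. 1 \<le> j \<and> j \<le> n \<and> cf_digit x j \<noteq> 1}"

definition gamma0 :: real where
  "gamma0 = 2 * ln ((1 + sqrt 5) / 2)"

definition set_A :: "real set" where
  "set_A = {x \<in> irrationals01.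
     (\<lambda>n. 1 / real n * ln (real (cf_denom x n))) \<longlonglongrightarrow> gamma0 / 2}"

definition set_B :: "real set" where
  "set_B = {x \<in> irrationals01.
     (\<lambda>n. 1 / real n * (\<Sum>j=1..n. ln (real (cf_digit x j)))) \<longlonglongrightarrow> 0}"

definition set_C :: "real set" where
  "set_C = {x \<in> irrationals01.
     (\<lambda>n. 1 / real n * real (card (non_one_indices x n))) \<longlonglongrightarrow> 0}"

text \<open>The value of \<open>1 / (a\<^sub>1 + 1 / (a\<^sub>2 + \<dots> + 1 / (a\<^sub>n + t)))\<close>; the facts below confirm that the
  digits and the recursions describe the expansion of \<open>x\<close> and its reduced convergents.\<close>

definition cf_value :: "nat list \<Rightarrow> real \<Rightarrow> real" where
  "cf_value as t = foldr (\<lambda>a s. 1 / (real a + s)) as t"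

lemma gauss_iterate_bounds:
  assumes "x \<in> irrationals01"
  shows "0 < (gauss_map ^^ n) x \<and> (gauss_map ^^ n) x < 1 \<and> (gauss_map ^^ n) x \<notin> \<rat>"
proof (induction n)
  case 0
  have "x \<noteq> 0" "x \<noteq> 1" using assms by (auto simp: irrationals01_def)
  then show ?case using assms by (auto simp: irrationals01_def)
next
  case (Suc n)
  let ?y = "(gauss_map ^^ n) x"
  have inv: "1 / ?y \<notin> \<rat>"
  proof
    assume "1 / ?y \<in> \<rat>"
    then have "1 / (1 / ?y) \<in> \<rat>" by (rule Rats_divide[OF Rats_1])
    then show False using Suc by simp
  qed
  have nr: "frac (1 / ?y) \<notin> \<rat>"
  proof
    assume "frac (1 / ?y) \<in> \<rat>"
    then have "frac (1 / ?y) + of_int \<lfloor>1 / ?y\<rfloor> \<in> \<rat>" by (intro Rats_add) auto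
    then show False using inv by (simp add: frac_def)
  qed
  then have "frac (1 / ?y) \<noteq> 0" by (metis Rats_0)
  then have "0 < frac (1 / ?y)" using frac_ge_0[of "1 / ?y"] by linarith
  then show ?case using nr by (simp add: gauss_map_def[of ?y] frac_lt_1)
qed

lemma cf_digit_pos:
  assumes "x \<in> irrationals01"
  shows "cf_digit x (Suc n) \<ge> 1"
proof -
  have "1 \<le> 1 / (gauss_map ^^ n) x"
    using gauss_iterate_bounds[OF assms, of n] by simp
  then have "1 \<le> \<lfloor>1 / (gauss_map ^^ n) x\<rfloor>" by (simp only: one_le_floor)
  then have "nat 1 \<le> nat \<lfloor>1 / (gauss_map ^^ n) x\<rfloor>" by (rule nat_mono)
  then show ?thesis by simp
qed

lemma cf_denom_pos:
  assumes "x \<in> irrationals01"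
  shows "cf_denom x n \<ge> 1"
  using assms
proof (induction x n rule: cf_denom.induct)
  case (2 x)
  then show ?case using cf_digit_pos[of x 0] by (simp del: cf_digit.simps)
qed simp_all

lemma cf_value_tail:
  assumes "x \<in> irrationals01" and "t \<ge> 0"
  shows "cf_value (map (cf_digit x) [1..<Suc (Suc n)]) t =
    (real (cf_num x (Suc n)) + t * real (cf_num x n)) /
    (real (cf_denom x (Suc n)) + t * real (cf_denom x n))"
  using assms(2)
proof (induction n arbitrary: t)
  case 0
  then show ?case by (simp add: cf_value_def)
next
  case (Suc n)
  define a where "a = real (cf_digit x (Suc (Suc n)))"
  have a: "a \<ge> 1" using cf_digit_pos[OF assms(1), of "Suc n"] unfolding a_def by linarith
  have pos: "a + t > 0" using a Suc.prems by linarith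
  have "cf_value (map (cf_digit x) [1..<Suc (Suc (Suc n))]) t =
      cf_value (map (cf_digit x) [1..<Suc (Suc n)]) (1 / (a + t))"
    by (simp add: cf_value_def a_def del: cf_digit.simps)
  also have "\<dots> = (real (cf_num x (Suc n)) + 1 / (a + t) * real (cf_num x n)) /
      (real (cf_denom x (Suc n)) + 1 / (a + t) * real (cf_denom x n))"
    using pos by (intro Suc.IH) simp
  also have "\<dots> = ((a + t) * (real (cf_num x (Suc n)) + 1 / (a + t) * real (cf_num x n))) /
      ((a + t) * (real (cf_denom x (Suc n)) + 1 / (a + t) * real (cf_denom x n)))"
    using pos by simp
  also have "\<dots> = (real (cf_num x (Suc (Suc n))) + t * real (cf_num x (Suc n))) /
      (real (cf_denom x (Suc (Suc n))) + t * real (cf_denom x (Suc n)))"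
  proof -
    have "(a + t) * (u + 1 / (a + t) * v) = (a * u + v) + t * u" for u v
      using pos by (simp add: field_simps)
    then show ?thesis by (simp add: a_def del: cf_digit.simps)
  qed
  finally show ?case .
qed

lemma cf_convergent:
  assumes "x \<in> irrationals01"
  shows "cf_value (map (cf_digit x) [1..<Suc n]) 0 = real (cf_num x n) / real (cf_denom x n)"
  using cf_value_tail[OF assms, of 0] by (cases n) (auto simp: cf_value_def)

lemma cf_determinant:
  "int (cf_num x (Suc n)) * int (cf_denom x n) - int (cf_num x n) * int (cf_denom x (Suc n)) = (-1) ^ n"
  by (induction n) (auto simp: algebra_simps)

lemma cf_coprime: "coprime (cf_num x n) (cf_denom x n)"
proof -
  have "coprime (int (cf_num x n)) (int (cf_denom x n))"
  proof (rule coprimeI)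
    fix d assume "d dvd int (cf_num x n)" "d dvd int (cf_denom x n)"
    then have "d dvd (-1) ^ n"
      unfolding cf_determinant[of x n, symmetric] by simp
    then show "is_unit d" by (metis dvd_trans is_unit_power_iff dvd_minus_iff dvd_refl)
  qed
  then show ?thesis by simp
qed

lemma cf_expansion:
  assumes "x \<in> irrationals01"
  shows "cf_value (map (cf_digit x) [1..<Suc n]) ((gauss_map ^^ n) x) = x"
proof (induction n)
  case 0
  then show ?case by (simp add: cf_value_def)
next
  case (Suc n)
  let ?y = "(gauss_map ^^ n) x"
  have y: "0 < ?y" "?y < 1" using gauss_iterate_bounds[OF assms, of n] by auto
  then have "0 \<le> \<lfloor>1 / ?y\<rfloor>" by simp
  then have "real (cf_digit x (Suc n)) + (gauss_map ^^ Suc n) x = 1 / ?y"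
    by (simp add: gauss_map_def frac_def)
  then have "1 / (real (cf_digit x (Suc n)) + (gauss_map ^^ Suc n) x) = ?y" by simp
  then have "cf_value (map (cf_digit x) [1..<Suc (Suc n)]) ((gauss_map ^^ Suc n) x) =
      cf_value (map (cf_digit x) [1..<Suc n]) ?y"
    by (simp add: cf_value_def del: cf_digit.simps funpow.simps)
  then show ?case using Suc.IH by simp
qed

end

theory Submission
  imports Defs
begin

text \<open>Write \<open>\<phi>\<close> for the golden ratio and \<open>S\<^sub>n = \<Sum>\<^sub>j\<^sub>\<le>\<^sub>n ln a\<^sub>j\<close>. Everything follows from
  \<open>n ln \<phi> + S\<^sub>n / 3 - ln 3 \<le> ln q\<^sub>n \<le> n ln \<phi> + S\<^sub>n\<close>.
  The upper bound is immediate from \<open>q\<^sub>n \<le> a\<^sub>n (q\<^sub>n\<^sub>-\<^sub>1 + q\<^sub>n\<^sub>-\<^sub>2)\<close>. For the lower bound put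
  \<open>L\<^sub>n = \<phi> q\<^sub>n + q\<^sub>n\<^sub>-\<^sub>1\<close>. A digit 1 multiplies \<open>L\<close> by exactly \<open>\<phi>\<close>, and in general
  \<open>L\<^sub>n = \<phi> (L\<^sub>n\<^sub>-\<^sub>1 + (a\<^sub>n - 1) q\<^sub>n\<^sub>-\<^sub>1) \<ge> \<phi> L\<^sub>n\<^sub>-\<^sub>1 (1 + (a\<^sub>n - 1) / 3)\<close>,
  where \<open>1 + (a - 1) / 3 \<ge> a\<^sup>1\<^sup>/\<^sup>3\<close> by the AM-GM inequality.\<close>

section \<open>Elementary facts about the golden ratio\<close>

definition golden :: real where
  "golden = (1 + sqrt 5) / 2"

lemma golden_square: "golden * golden = golden + 1"
  by (simp add: golden_def field_simps)

lemma golden_gt_1: "1 < golden"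
  by (simp add: golden_def)

lemma golden_le_2: "golden \<le> 2"
proof -
  have "sqrt 5 \<le> 3" by (rule real_le_lsqrt) simp_all
  then show ?thesis by (simp add: golden_def)
qed

lemma gamma0_golden: "gamma0 / 2 = ln golden"
  by (simp add: gamma0_def golden_def)

section \<open>Denominators against products over the digits\<close>

lemma real_cf_digit_ge_1:
  assumes "x \<in> irrationals01" and "1 \<le> j"
  shows "1 \<le> real (cf_digit x j)"
  using cf_digit_pos[OF assms(1), of "j - 1"] assms(2) by (simp del: cf_digit.simps)

lemma cf_denom_le_Suc:
  assumes "x \<in> irrationals01"
  shows "cf_denom x n \<le> cf_denom x (Suc n)"
proof (cases n)
  case 0
  then show ?thesis using cf_digit_pos[OF assms, of 0] by (simp del: cf_digit.simps)
next
  case (Suc m)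
  have "1 * cf_denom x n \<le> cf_digit x (Suc n) * cf_denom x n"
    using cf_digit_pos[OF assms, of n] by (intro mult_right_mono) auto
  then show ?thesis unfolding Suc cf_denom.simps by linarith
qed

text \<open>Two-step induction: once both earlier denominators are bounded by multiples of the same
  product, the recursion contributes the factor \<open>golden + 1 = golden * golden\<close>.\<close>

lemma cf_denom_le_golden_prod:
  assumes "x \<in> irrationals01"
  shows "real (cf_denom x n) \<le> golden ^ n * (\<Prod>j=1..n. real (cf_digit x j))"
  using assms
proof (induction x n rule: cf_denom.induct)
  case (1 x)
  then show ?case by simp
next
  case (2 x)
  have "1 * real (cf_digit x 1) \<le> golden * real (cf_digit x 1)"
    using golden_gt_1 by (intro mult_right_mono) auto
  then show ?case by (simp del: cf_digit.simps)
next
  case (3 x n)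
  define P where "P = golden ^ n * (\<Prod>j=1..n. real (cf_digit x j))"
  define a where "a = real (cf_digit x (Suc n))"
  define b where "b = real (cf_digit x (Suc (Suc n)))"
  have ab: "1 \<le> a" "1 \<le> b"
    using real_cf_digit_ge_1[OF 3(3)] by (auto simp: a_def b_def simp del: cf_digit.simps)
  have P0: "0 \<le> P"
    using golden_gt_1 by (auto simp: P_def intro!: mult_nonneg_nonneg prod_nonneg)
  have IH1: "real (cf_denom x (Suc n)) \<le> golden * a * P"
    using 3(1)[OF 3(3)] by (simp add: P_def a_def mult_ac del: cf_digit.simps cf_denom.simps)
  have IH2: "real (cf_denom x n) \<le> P"
    using 3(2)[OF 3(3)] by (simp add: P_def)
  \<comment> \<open>The bound on \<open>cf_denom x n\<close> lacks the two newest digits; inserting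
    them only enlarges it.\<close>
  have "1 * 1 \<le> a * b" using ab by (intro mult_mono) auto
  then have abP: "1 * P \<le> a * b * P" using P0 by (intro mult_right_mono) auto
  have "real (cf_denom x (Suc (Suc n))) = b * real (cf_denom x (Suc n)) + real (cf_denom x n)"
    by (simp add: b_def del: cf_digit.simps)
  also have "\<dots> \<le> b * (golden * a * P) + a * b * P"
    using IH1 IH2 ab abP by (intro add_mono mult_left_mono) auto
  also have "\<dots> = (golden + 1) * (a * b * P)" by (simp add: algebra_simps)
  also have "\<dots> = golden ^ Suc (Suc n) * (\<Prod>j=1..Suc (Suc n). real (cf_digit x j))"
    unfolding golden_square[symmetric]
    by (simp add: P_def a_def b_def mult_ac del: cf_digit.simps)
  finally show ?case .
qed

text \<open>The right side is the linear form that a digit 1 scales by exactly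
  \<open>golden\<close>, i.e. an eigenvector for the step with digit 1. The induction starts at
  index 1, since the form at index 0 would involve the denominator of index -1.\<close>

lemma golden_form_ge_prod:
  assumes "x \<in> irrationals01"
  shows "golden ^ Suc n * (\<Prod>j=1..Suc n. (real (cf_digit x j) + 2) / 3)
    \<le> golden * real (cf_denom x (Suc n)) + real (cf_denom x n)"
proof (induction n)
  case 0
  have "1 \<le> real (cf_digit x 1)" by (rule real_cf_digit_ge_1[OF assms order_refl])
  then have "golden * ((real (cf_digit x 1) + 2) / 3) \<le> golden * real (cf_digit x 1)"
    using golden_gt_1 by (intro mult_left_mono) auto
  then show ?case by (simp del: cf_digit.simps)
next
  case (Suc n)
  define a where "a = real (cf_digit x (Suc (Suc n)))"
  define u where "u = real (cf_denom x (Suc n))"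
  define v where "v = real (cf_denom x n)"
  have a: "1 \<le> a"
    using real_cf_digit_ge_1[OF assms] by (simp add: a_def del: cf_digit.simps)
  have vu: "v \<le> u" "0 \<le> u"
    using cf_denom_le_Suc[OF assms, of n] by (auto simp: u_def v_def)
  have "golden * u \<le> 2 * u" using golden_le_2 vu by (intro mult_right_mono) auto
  \<comment> \<open>The 3 is 2 + 1, from \<open>golden \<le> 2\<close> and \<open>v \<le> u\<close>;
    it is the denominator in the factor \<open>(a + 2) / 3 = 1 + (a - 1) / 3\<close>.\<close>
  then have "golden * u + v \<le> 3 * u" using vu by linarith
  then have "(a - 1) * (golden * u + v) \<le> (a - 1) * (3 * u)"
    using a by (intro mult_left_mono) auto
  then have le: "(a + 2) / 3 * (golden * u + v) \<le> golden * u + v + (a - 1) * u"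
    by (simp add: field_simps)
  have "golden ^ Suc (Suc n) * (\<Prod>j=1..Suc (Suc n). (real (cf_digit x j) + 2) / 3)
      = golden * ((a + 2) / 3 * (golden ^ Suc n * (\<Prod>j=1..Suc n. (real (cf_digit x j) + 2) / 3)))"
    by (simp add: a_def mult_ac del: cf_digit.simps)
  also have "\<dots> \<le> golden * ((a + 2) / 3 * (golden * u + v))"
    using Suc.IH golden_gt_1 a unfolding u_def v_def
    by (intro mult_left_mono) auto
  also have "\<dots> \<le> golden * (golden * u + v + (a - 1) * u)"
    using le golden_gt_1 by (intro mult_left_mono) auto
  also have "\<dots> = (golden * golden) * u + golden * (v + (a - 1) * u)"
    by (simp add: algebra_simps)
  also have "\<dots> = golden * (a * u + v) + u"
    unfolding golden_square by (simp add: algebra_simps)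
  also have "\<dots> = golden * real (cf_denom x (Suc (Suc n))) + real (cf_denom x (Suc n))"
    by (simp add: a_def u_def v_def del: cf_digit.simps)
  finally show ?case .
qed

text \<open>Returning from the linear form to the denominator costs only the constant factor 3,
  which disappears after taking logarithms and dividing by \<open>n\<close>.\<close>

lemma golden_prod_le_cf_denom:
  assumes "x \<in> irrationals01"
  shows "golden ^ n * (\<Prod>j=1..n. (real (cf_digit x j) + 2) / 3) \<le> 3 * real (cf_denom x n)"
proof (cases n)
  case 0
  then show ?thesis by simp
next
  case (Suc m)
  have "golden * real (cf_denom x n) \<le> 2 * real (cf_denom x n)"
    using golden_le_2 by (intro mult_right_mono) auto
  moreover have "real (cf_denom x m) \<le> real (cf_denom x n)"
    using cf_denom_le_Suc[OF assms, of m] Suc by simp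
  ultimately show ?thesis
    using golden_form_ge_prod[OF assms, of m] unfolding Suc by linarith
qed

section \<open>Logarithmic form of the bounds\<close>

lemma ln_third_le:
  fixes a :: real
  assumes "1 \<le> a"
  shows "ln a / 3 \<le> ln ((a + 2) / 3)"
proof -
  \<comment> \<open>This product equals \<open>(a + 2) ^ 3 - 27 * a\<close>, so its sign is the
    AM-GM inequality for a, 1, 1.\<close>
  have "0 \<le> (a - 1) ^ 2 * (a + 8)" using assms by simp
  then have "a \<le> ((a + 2) / 3) ^ 3"
    by (simp add: power2_eq_square power3_eq_cube field_simps)
  then have "ln a \<le> ln (((a + 2) / 3) ^ 3)" using assms by (simp add: ln_le_cancel_iff)
  also have "\<dots> = 3 * ln ((a + 2) / 3)" using assms by (subst ln_realpow) simp_all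
  finally show ?thesis by simp
qed

lemma ln_cf_denom_upper:
  assumes "x \<in> irrationals01"
  shows "ln (real (cf_denom x n)) \<le> real n * ln golden + (\<Sum>j=1..n. ln (real (cf_digit x j)))"
proof -
  have digit: "0 < real (cf_digit x j)" if "j \<in> {1..n}" for j
    using real_cf_digit_ge_1[OF assms, of j] that by simp
  have "ln (real (cf_denom x n)) \<le> ln (golden ^ n * (\<Prod>j=1..n. real (cf_digit x j)))"
    using cf_denom_le_golden_prod[OF assms, of n] cf_denom_pos[OF assms, of n]
    by (intro ln_mono) auto
  also have "\<dots> = ln (golden ^ n) + ln (\<Prod>j=1..n. real (cf_digit x j))"
    using golden_gt_1 digit by (intro ln_mult_pos prod_pos) auto
  also have "\<dots> = real n * ln golden + (\<Sum>j=1..n. ln (real (cf_digit x j)))"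
    using golden_gt_1 digit by (subst ln_prod) (auto simp: ln_realpow)
  finally show ?thesis .
qed

lemma ln_cf_denom_lower:
  assumes "x \<in> irrationals01"
  shows "real n * ln golden + (\<Sum>j=1..n. ln (real (cf_digit x j))) / 3 - ln 3
    \<le> ln (real (cf_denom x n))"
proof -
  have digit: "1 \<le> real (cf_digit x j)" if "j \<in> {1..n}" for j
    using real_cf_digit_ge_1[OF assms, of j] that by simp
  have pos: "0 < (real (cf_digit x j) + 2) / 3" for j by simp
  have "real n * ln golden + (\<Sum>j=1..n. ln (real (cf_digit x j))) / 3
      \<le> real n * ln golden + (\<Sum>j=1..n. ln ((real (cf_digit x j) + 2) / 3))"
    unfolding sum_divide_distrib using digit by (intro add_left_mono sum_mono ln_third_le)
  also have "\<dots> = ln (golden ^ n) + ln (\<Prod>j=1..n. (real (cf_digit x j) + 2) / 3)"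
    using golden_gt_1 pos by (subst ln_prod) (auto simp: ln_realpow)
  also have "\<dots> = ln (golden ^ n * (\<Prod>j=1..n. (real (cf_digit x j) + 2) / 3))"
    using golden_gt_1 pos by (intro ln_mult_pos[symmetric] prod_pos) auto
  also have "\<dots> \<le> ln (3 * real (cf_denom x n))"
    using golden_prod_le_cf_denom[OF assms, of n] golden_gt_1 pos
    by (intro ln_mono mult_pos_pos prod_pos) auto
  also have "\<dots> = ln 3 + ln (real (cf_denom x n))"
    using cf_denom_pos[OF assms, of n] by (intro ln_mult_pos) auto
  finally show ?thesis by simp
qed

section \<open>Digits other than 1\<close>

lemma ln_cf_digit_nonneg: "0 \<le> ln (real (cf_digit x j))"
  \<comment> \<open>A zero digit is covered by the convention \<open>ln 0 = 0\<close>.\<close>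
  by (cases "cf_digit x j") simp_all

text \<open>Each digit other than 1 is at least 2, so it adds at least \<open>ln 2\<close> to the
  sum, and the remaining terms are nonnegative.\<close>

lemma card_non_one_indices_le:
  assumes "x \<in> irrationals01"
  shows "ln 2 * real (card (non_one_indices x n)) \<le> (\<Sum>j=1..n. ln (real (cf_digit x j)))"
proof -
  have sub: "non_one_indices x n \<subseteq> {1..n}" by (auto simp: non_one_indices_def)
  have "ln 2 * real (card (non_one_indices x n)) = (\<Sum>j\<in>non_one_indices x n. ln 2)" by simp
  also have "\<dots> \<le> (\<Sum>j\<in>non_one_indices x n. ln (real (cf_digit x j)))"
  proof (rule sum_mono)
    fix j assume j: "j \<in> non_one_indices x n"
    then have "1 \<le> real (cf_digit x j)" "cf_digit x j \<noteq> 1"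
      using real_cf_digit_ge_1[OF assms, of j] by (auto simp: non_one_indices_def)
    then have "2 \<le> cf_digit x j" by linarith
    then show "ln 2 \<le> ln (real (cf_digit x j))" by simp
  qed
  also have "\<dots> \<le> (\<Sum>j=1..n. ln (real (cf_digit x j)))"
    using sub by (intro sum_mono2 ln_cf_digit_nonneg) auto
  finally show ?thesis .
qed

section \<open>Passage to the limit\<close>

lemma const_over_n_tendsto_0: "(\<lambda>n. c / real n) \<longlonglongrightarrow> 0"
  using tendsto_mult_right_zero[OF lim_inverse_n, of c] by (simp add: divide_inverse)

theorem lemma2p8: "set_A = set_B \<and> set_B \<subseteq> set_C"
proof -
  have AB: "(\<lambda>n. 1 / real n * ln (real (cf_denom x n))) \<longlonglongrightarrow> gamma0 / 2 \<longleftrightarrow>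
      (\<lambda>n. 1 / real n * (\<Sum>j=1..n. ln (real (cf_digit x j)))) \<longlonglongrightarrow> 0"
    and BC: "(\<lambda>n. 1 / real n * (\<Sum>j=1..n. ln (real (cf_digit x j)))) \<longlonglongrightarrow> 0 \<Longrightarrow>
      (\<lambda>n. 1 / real n * real (card (non_one_indices x n))) \<longlonglongrightarrow> 0"
    if x: "x \<in> irrationals01" for x
  proof -
    let ?A = "\<lambda>n. 1 / real n * ln (real (cf_denom x n))"
    let ?B = "\<lambda>n. 1 / real n * (\<Sum>j=1..n. ln (real (cf_digit x j)))"
    have upper: "\<forall>\<^sub>F n in sequentially. ?A n \<le> ln golden + ?B n"
      using eventually_gt_at_top[of 0]
    proof eventually_elim
      case (elim n)
      then show ?case using ln_cf_denom_upper[OF x, of n] by (simp add: field_simps)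
    qed
    \<comment> \<open>At \<open>n = 0\<close> every quotient by \<open>n\<close> is 0 by convention
      and the inequality would read \<open>ln golden \<le> 0\<close>, so it is claimed only
      eventually.\<close>
    have lower: "\<forall>\<^sub>F n in sequentially. ln golden + ?B n / 3 - ln 3 / real n \<le> ?A n"
      using eventually_gt_at_top[of 0]
    proof eventually_elim
      case (elim n)
      then show ?case
        using divide_right_mono[OF ln_cf_denom_lower[OF x, of n], of "real n"]
        by (simp add: add_divide_distrib diff_divide_distrib mult.commute)
    qed
    have nonneg: "0 \<le> ?B n" for n
      by (intro mult_nonneg_nonneg sum_nonneg ln_cf_digit_nonneg) simp
    show "?A \<longlonglongrightarrow> gamma0 / 2 \<longleftrightarrow> ?B \<longlonglongrightarrow> 0"
      unfolding gamma0_golden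
    proof
      assume A: "?A \<longlonglongrightarrow> ln golden"
      \<comment> \<open>This is \<open>lower\<close> solved for \<open>?B n\<close>; together with
        \<open>nonneg\<close> it squeezes \<open>?B\<close> to 0.\<close>
      have "(\<lambda>n. 3 * (?A n - ln golden + ln 3 / real n)) \<longlonglongrightarrow> 3 * (ln golden - ln golden + 0)"
        by (intro tendsto_intros A const_over_n_tendsto_0)
      then have lim: "(\<lambda>n. 3 * (?A n - ln golden + ln 3 / real n)) \<longlonglongrightarrow> 0" by simp
      have "\<forall>\<^sub>F n in sequentially. ?B n \<le> 3 * (?A n - ln golden + ln 3 / real n)"
        using lower by eventually_elim argo
      then show "?B \<longlonglongrightarrow> 0"
        by (intro tendsto_sandwich[OF _ _ tendsto_const lim]) (simp_all only: nonneg eventually_True)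
    next
      assume B: "?B \<longlonglongrightarrow> 0"
      \<comment> \<open>If \<open>?B\<close> vanishes in the limit, both outer bounds on
        \<open>?A\<close> tend to \<open>ln golden\<close>, despite their different factors on
        \<open>?B\<close>.\<close>
      have "(\<lambda>n. ln golden + ?B n / 3 - ln 3 / real n) \<longlonglongrightarrow> ln golden + 0 / 3 - 0"
        by (intro tendsto_intros B const_over_n_tendsto_0) simp
      moreover have "(\<lambda>n. ln golden + ?B n) \<longlonglongrightarrow> ln golden + 0"
        by (intro tendsto_intros B)
      ultimately show "?A \<longlonglongrightarrow> ln golden"
        using tendsto_sandwich[OF lower upper] by simp
    qed
    assume B: "?B \<longlonglongrightarrow> 0"
    \<comment> \<open>The frequency of digits other than 1 is squeezed between 0 and
      \<open>?B n / ln 2\<close>.\<close>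
    have "(\<lambda>n. ?B n / ln 2) \<longlonglongrightarrow> 0 / ln 2" by (intro tendsto_intros B) simp
    then have lim: "(\<lambda>n. ?B n / ln 2) \<longlonglongrightarrow> 0" by simp
    have le: "1 / real n * real (card (non_one_indices x n)) \<le> ?B n / ln 2" for n
    proof -
      have "real (card (non_one_indices x n)) \<le> (\<Sum>j=1..n. ln (real (cf_digit x j))) / ln 2"
        using card_non_one_indices_le[OF x, of n] by (simp add: field_simps)
      then have "1 / real n * real (card (non_one_indices x n))
          \<le> 1 / real n * ((\<Sum>j=1..n. ln (real (cf_digit x j))) / ln 2)"
        by (intro mult_left_mono) auto
      then show ?thesis by simp
    qed
    show "(\<lambda>n. 1 / real n * real (card (non_one_indices x n))) \<longlonglongrightarrow> 0"
      by (rule tendsto_sandwich[OF _ _ tendsto_const lim]) (simp, intro always_eventually allI le)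
  qed
  show ?thesis using AB BC by (auto simp: set_A_def set_B_def set_C_def)
qed

end
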